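(* There exists $n_0\in\mathbb N$ such that for every integer $n>n_0$, the random graph $G(n,\frac12)$ satisfies $$\Pr\left(\kappa_Q\left(G(n,\tfrac12)\right)<0.811\,n\right)\ge 1-\frac1n .$$
   Context: $G(n,\frac12)$ is the random simple graph on $n$ vertices in which each pair of distinct vertices is joined by an edge independently with probability $1/2$. For a finite simple undirected graph $G=(V,E)$ and $C\subseteq V$, let $Odd(C)=\{v\in V : |N(v)\cap C|\equiv 1 \pmod 2\}$, where $N(v)$ is the open neighborhood of $v$. A set $B\subseteq V$ is a weak odd dominated (WOD) set if there exists $C\subseteq V\setminus B$ with $B\subseteq Odd(C)$. Let $\kappa(G)$ be the maximum size of a WOD set of $G$ and $\kappa'(G)$ the minimum size of a subset of $V$ that is not a WOD set. With $n=|V|$, $\kappa_Q(G)=\max(\kappa(G),\,n-\kappa'(G))$. *)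

theory Defs
  imports "HOL-Probability.Probability"
begin

text \<open>A graph is a pair of a vertex set and a set of undirected edges, an edge being a
  two-element set of vertices.\<close>

type_synonym 'a ugraph = "'a set \<times> 'a set set"

abbreviation verts :: "'a ugraph \<Rightarrow> 'a set" where
  "verts G \<equiv> fst G"

abbreviation edges :: "'a ugraph \<Rightarrow> 'a set set" where
  "edges G \<equiv> snd G"

definition all_edges :: "'a set \<Rightarrow> 'a set set" where
  "all_edges V = {e. e \<subseteq> V \<and> card e = 2}"

definition simple_graph :: "'a ugraph \<Rightarrow> bool" where
  "simple_graph G \<longleftrightarrow> finite (verts G) \<and> edges G \<subseteq> all_edges (verts G)"

definition neighbourhood :: "'a ugraph \<Rightarrow> 'a \<Rightarrow> 'a set" where
  "neighbourhood G v = {u \<in> verts G. {u, v} \<in> edges G}"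

definition odd_nbhd :: "'a ugraph \<Rightarrow> 'a set \<Rightarrow> 'a set" where
  "odd_nbhd G C = {v \<in> verts G. odd (card (neighbourhood G v \<inter> C))}"

definition wod_set :: "'a ugraph \<Rightarrow> 'a set \<Rightarrow> bool" where
  "wod_set G B \<longleftrightarrow> B \<subseteq> verts G \<and> (\<exists>C. C \<subseteq> verts G - B \<and> B \<subseteq> odd_nbhd G C)"

definition kappa :: "'a ugraph \<Rightarrow> nat" where
  "kappa G = Max (card ` {B. wod_set G B})"

definition kappa' :: "'a ugraph \<Rightarrow> nat" where
  "kappa' G = Min (card ` {B. B \<subseteq> verts G \<and> \<not> wod_set G B})"

text \<open>The subtraction is on natural numbers; it does not truncate for a finite nonempty vertex
  set, by \<open>kappa'_le_card\<close> below.\<close>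

definition kappa_Q :: "'a ugraph \<Rightarrow> nat" where
  "kappa_Q G = max (kappa G) (card (verts G) - kappa' G)"

text \<open>The Erdos-Renyi graph on the vertices \<open>0, \<dots>, n - 1\<close>: one independent Bernoulli variable
  per potential edge. The second argument of \<open>Pi_pmf\<close> is merely the value of the sampled
  function outside its index set.\<close>

definition random_graph :: "nat \<Rightarrow> real \<Rightarrow> nat ugraph pmf" where
  "random_graph n p =
     map_pmf (\<lambda>f. ({..<n}, {e \<in> all_edges {..<n}. f e}))
       (Pi_pmf (all_edges {..<n}) False (\<lambda>_. bernoulli_pmf p))"

text \<open>The maximum and the minimum above range over finite nonempty sets.\<close>

lemma finite_wod_sets: "finite (verts G) \<Longrightarrow> finite {B. wod_set G B}"
  by (rule finite_subset[of _ "Pow (verts G)"]) (auto simp: wod_set_def)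

lemma wod_set_empty: "wod_set G {}"
  by (auto simp: wod_set_def)

lemma not_wod_set_verts: "verts G \<noteq> {} \<Longrightarrow> \<not> wod_set G (verts G)"
  by (auto simp: wod_set_def odd_nbhd_def)

lemma kappa'_le_card:
  assumes "finite (verts G)" "verts G \<noteq> {}"
  shows "kappa' G \<le> card (verts G)"
  unfolding kappa'_def
  by (rule Min_le) (use assms not_wod_set_verts[of G] in auto)

lemma simple_random_graph:
  assumes "G \<in> set_pmf (random_graph n p)"
  shows "verts G = {..<n}" "simple_graph G"
  using assms by (auto simp: random_graph_def simple_graph_def)

end

theory Submission
  imports Defs
begin

text \<open>If \<open>\<kappa>\<^sub>Q(G) \<ge> r > 0\<close>, then there is a nonempty \<open>C\<close> such that, among the vertices outside \<open>C\<close>,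
  at least \<open>r\<close> lie in \<open>Odd(C)\<close>, or at least \<open>r\<close> do not. For \<open>\<kappa>\<close> this is the definition; for \<open>\<kappa>'\<close> it
  is linear duality over the field with two elements, which turns a set \<open>B\<close> that is not WOD into
  a \<open>C \<subseteq> B\<close> of odd size with \<open>Odd(C) \<subseteq> B\<close>. In the random graph \<open>Odd(C) - C\<close> is a uniform subset of \<open>V - C\<close>, so
  Markov's inequality for \<open>13 ^ card S\<close> bounds each of the two events by
  \<open>7 ^ (n - card C) / 13 powr r\<close>. Summing over \<open>C\<close> gives \<open>2 * 8 ^ n / 13 powr r\<close>, and \<open>8 < 13 powr 0.811\<close>.
  The base \<open>13\<close> is nearly the optimal value \<open>3 * 0.811 / 0.189\<close>; the margin is narrow, so the
  constant \<open>0.811\<close> leaves little choice.\<close>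

section \<open>Parity\<close>

text \<open>Elements of \<open>A \<inter> B\<close> are counted twice in
  \<open>card A + card B\<close>. Symmetric difference thus plays the role of addition over the
  field with two elements.\<close>

lemma odd_card_sym_diff:
  assumes "finite A" "finite B"
  shows "odd (card (sym_diff A B)) \<longleftrightarrow> odd (card A) \<noteq> odd (card B)"
proof -
  have "card A = card (A - B) + card (A \<inter> B)"
    using assms by (metis Int_Diff_disjoint Un_Diff_Int card_Un_disjoint finite_Diff finite_Int inf_commute)
  moreover have "card B = card (B - A) + card (A \<inter> B)"
    using assms by (metis Int_Diff_disjoint Un_Diff_Int card_Un_disjoint finite_Diff finite_Int inf_commute)
  moreover have "card (sym_diff A B) = card (A - B) + card (B - A)"
    using assms by (intro card_Un_disjoint) auto
  ultimately show ?thesis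
    by auto
qed

lemma odd_card_sym_diff_Int:
  assumes "finite A" "finite B"
  shows "odd (card (sym_diff A B \<inter> X)) \<longleftrightarrow> odd (card (A \<inter> X)) \<noteq> odd (card (B \<inter> X))"
proof -
  have "sym_diff A B \<inter> X = sym_diff (A \<inter> X) (B \<inter> X)"
    by auto
  then show ?thesis
    using odd_card_sym_diff[of "A \<inter> X" "B \<inter> X"] assms by simp
qed

text \<open>The solvability criterion for a linear system over the field with two elements: rows \<open>B\<close>,
  columns \<open>W\<close>, coefficients \<open>R\<close>, right-hand side \<open>b\<close>.\<close>

lemma parity_alternative:
  assumes "finite W" "finite B"
  shows "(\<exists>C\<subseteq>W. \<forall>v\<in>B. odd (card (C \<inter> {w. R v w})) \<longleftrightarrow> v \<in> b) \<or>
         (\<exists>D\<subseteq>B. odd (card (D \<inter> b)) \<and> (\<forall>w\<in>W. even (card (D \<inter> {v. R v w}))))"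
  using assms(1)
proof (induction W arbitrary: b rule: finite_induct)
  case empty
  show ?case
  proof (cases "B \<inter> b = {}")
    case True
    then show ?thesis by auto
  next
    case False
    then obtain v where "v \<in> B" "v \<in> b" by auto
    then have "{v} \<subseteq> B" "odd (card ({v} \<inter> b))" by auto
    then show ?thesis by blast
  qed
next
  case (insert w W)
  let ?a = "{v. R v w}"
  show ?case
  proof (rule disjCI)
    assume no_D: "\<not> (\<exists>D\<subseteq>B. odd (card (D \<inter> b)) \<and> (\<forall>w\<in>insert w W. even (card (D \<inter> {v. R v w}))))"
    show "\<exists>C\<subseteq>insert w W. \<forall>v\<in>B. odd (card (C \<inter> {w. R v w})) \<longleftrightarrow> v \<in> b"
    proof (rule ccontr)
      assume no_C: "\<not> ?thesis"
      \<comment> \<open>A solution that avoids the new column \<open>w\<close> would already solve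
        the larger system.\<close>
      have "\<not> (\<exists>C\<subseteq>W. \<forall>v\<in>B. odd (card (C \<inter> {w. R v w})) \<longleftrightarrow> v \<in> b)"
        using no_C by blast
      then obtain D1 where D1: "D1 \<subseteq> B" "odd (card (D1 \<inter> b))"
          "\<forall>w\<in>W. even (card (D1 \<inter> {v. R v w}))"
        using insert.IH[of b] by blast
      then have D1w: "odd (card (D1 \<inter> ?a))"
        using no_D by blast
      \<comment> \<open>Putting \<open>w\<close> into \<open>C\<close> adds the column
        \<open>?a\<close>, so a solution containing \<open>w\<close> is a solution over
        \<open>W\<close> with right-hand side \<open>b\<close> shifted by \<open>?a\<close>.\<close>
      have "\<not> (\<exists>C\<subseteq>W. \<forall>v\<in>B. odd (card (C \<inter> {w. R v w})) \<longleftrightarrow> v \<in> sym_diff b ?a)"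
      proof
        assume "\<exists>C\<subseteq>W. \<forall>v\<in>B. odd (card (C \<inter> {w. R v w})) \<longleftrightarrow> v \<in> sym_diff b ?a"
        then obtain C where C: "C \<subseteq> W"
            "\<forall>v\<in>B. odd (card (C \<inter> {w. R v w})) \<longleftrightarrow> v \<in> sym_diff b ?a" by blast
        have fin: "finite C" and "w \<notin> C"
          using C insert.hyps finite_subset by blast+
        then have "odd (card (insert w C \<inter> {w. R v w})) \<longleftrightarrow> v \<in> b" if "v \<in> B" for v
          using C(2) that by (cases "R v w") auto
        moreover have "insert w C \<subseteq> insert w W"
          using C(1) by blast
        ultimately show False
          using no_C by blast
      qed
      then obtain D2 where D2: "D2 \<subseteq> B" "odd (card (D2 \<inter> sym_diff b ?a))"
          "\<forall>w\<in>W. even (card (D2 \<inter> {v. R v w}))"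
        using insert.IH[of "sym_diff b ?a"] by blast
      have fin: "finite D1" "finite D2"
        using D1(1) D2(1) assms(2) finite_subset by blast+
      have "D2 \<inter> sym_diff b ?a = sym_diff (D2 \<inter> b) (D2 \<inter> ?a)"
        by auto
      then have D2b: "odd (card (D2 \<inter> b)) \<noteq> odd (card (D2 \<inter> ?a))"
        using D2(2) odd_card_sym_diff[of "D2 \<inter> b" "D2 \<inter> ?a"] fin by simp
      then have D2w: "odd (card (D2 \<inter> ?a))"
        using no_D D2(1,3) by blast
      \<comment> \<open>Both certificates fail exactly at \<open>w\<close>, so their sum is even on
        every column; it stays odd on \<open>b\<close> because \<open>D2\<close> is even
        there.\<close>
      have "sym_diff D1 D2 \<subseteq> B"
        using D1(1) D2(1) by blast
      moreover have "odd (card (sym_diff D1 D2 \<inter> b))"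
        using D1(2) D2b D2w odd_card_sym_diff_Int[OF fin] by blast
      moreover have "even (card (sym_diff D1 D2 \<inter> {v. R v w'}))" if "w' \<in> insert w W" for w'
        using that D1(3) D1w D2(3) D2w odd_card_sym_diff_Int[OF fin] by blast
      ultimately show False
        using no_D by blast
    qed
  qed
qed

section \<open>WOD sets\<close>

lemma neighbourhood_Int_eq:
  assumes "C \<subseteq> verts G"
  shows "neighbourhood G v \<inter> C = C \<inter> {u. {u, v} \<in> edges G}"
  using assms by (auto simp: neighbourhood_def)

lemma odd_nbhd_empty [simp]: "odd_nbhd G {} = {}"
  by (simp add: odd_nbhd_def)

text \<open>The system with rows \<open>B\<close>, columns \<open>verts G - B\<close> and all-ones
  right-hand side is unsolvable. Its certificate \<open>D\<close> has odd size, hence is nonempty,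
  and every vertex outside \<open>B\<close> has evenly many neighbours in \<open>D\<close>.\<close>

lemma not_wod_set_witness:
  assumes "finite (verts G)" "B \<subseteq> verts G" "\<not> wod_set G B"
  obtains D where "D \<subseteq> B" "D \<noteq> {}" "odd_nbhd G D \<subseteq> B"
proof -
  have fin: "finite (verts G - B)" "finite B"
    using assms finite_subset by auto
  have "\<not> (\<exists>C\<subseteq>verts G - B. \<forall>v\<in>B. odd (card (C \<inter> {w. {w, v} \<in> edges G})) \<longleftrightarrow> v \<in> UNIV)"
  proof
    assume "\<exists>C\<subseteq>verts G - B. \<forall>v\<in>B. odd (card (C \<inter> {w. {w, v} \<in> edges G})) \<longleftrightarrow> v \<in> UNIV"
    then obtain C where C: "C \<subseteq> verts G - B"
        "\<forall>v\<in>B. odd (card (C \<inter> {w. {w, v} \<in> edges G}))" by auto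
    then have "C \<subseteq> verts G"
      by blast
    then have "B \<subseteq> odd_nbhd G C"
      using C(2) assms(2) by (auto simp: odd_nbhd_def neighbourhood_Int_eq)
    then show False
      using assms C(1) by (auto simp: wod_set_def)
  qed
  then obtain D where D: "D \<subseteq> B" "odd (card (D \<inter> UNIV))"
      "\<forall>w\<in>verts G - B. even (card (D \<inter> {v. {w, v} \<in> edges G}))"
    using parity_alternative[OF fin, of "\<lambda>v w. {w, v} \<in> edges G" UNIV] by blast
  have "D \<subseteq> verts G"
    using D(1) assms(2) by blast
  then have "odd_nbhd G D \<subseteq> B"
    using D(3) by (auto simp: odd_nbhd_def neighbourhood_Int_eq insert_commute)
  moreover have "D \<noteq> {}"
    using D(2) by auto
  ultimately show ?thesis
    using that D(1) by blast
qed

text \<open>Both alternatives are phrased through \<open>odd_nbhd G C - C\<close> and its complement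
  in \<open>verts G - C\<close>, since this is the set that is uniform in the random graph.\<close>

lemma kappa_Q_ge_witness:
  assumes "finite (verts G)" "verts G \<noteq> {}" "0 < r" "r \<le> real (kappa_Q G)"
  obtains C where "C \<subseteq> verts G" "C \<noteq> {}"
    "r \<le> card (odd_nbhd G C - C) \<or> r \<le> card (verts G - C - (odd_nbhd G C - C))"
proof -
  consider "r \<le> kappa G" | "r \<le> card (verts G) - kappa' G"
    using assms(4) unfolding kappa_Q_def by linarith
  then show ?thesis
  proof cases
    case 1
    have "kappa G \<in> card ` {B. wod_set G B}"
      unfolding kappa_def using finite_wod_sets[OF assms(1)] wod_set_empty[of G]
      by (intro Max_in) auto
    then obtain B C where B: "kappa G = card B" "C \<subseteq> verts G - B" "B \<subseteq> odd_nbhd G C"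
      by (auto simp: wod_set_def)
    have "B \<subseteq> odd_nbhd G C - C"
      using B by blast
    moreover have "finite (odd_nbhd G C - C)"
      using assms(1) by (simp add: odd_nbhd_def)
    ultimately have "card B \<le> card (odd_nbhd G C - C)"
      by (intro card_mono)
    then have "r \<le> card (odd_nbhd G C - C)"
      using 1 B(1) by linarith
    \<comment> \<open>\<open>C = {}\<close> would force \<open>B = {}\<close>, against
      \<open>0 < r\<close>.\<close>
    moreover have "C \<noteq> {}"
      using B 1 assms(3) by auto
    ultimately show ?thesis
      using that B(2) by blast
  next
    case 2
    have "kappa' G \<in> card ` {B. B \<subseteq> verts G \<and> \<not> wod_set G B}"
      unfolding kappa'_def using assms(1) not_wod_set_verts[OF assms(2)]
      by (intro Min_in) auto
    then obtain B where B: "kappa' G = card B" "B \<subseteq> verts G" "\<not> wod_set G B"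
      by auto
    obtain D where D: "D \<subseteq> B" "D \<noteq> {}" "odd_nbhd G D \<subseteq> B"
      using not_wod_set_witness[OF assms(1) B(2,3)] .
    have "card (verts G) - kappa' G = card (verts G - B)"
      using B assms(1) by (simp add: card_Diff_subset finite_subset)
    also have "\<dots> \<le> card (verts G - D - (odd_nbhd G D - D))"
      using D assms(1) by (intro card_mono) auto
    finally have "r \<le> card (verts G - D - (odd_nbhd G D - D))"
      using 2 by linarith
    then show ?thesis
      using that D B(2) by blast
  qed
qed

section \<open>The odd neighbourhood in a random graph\<close>

lemma finite_all_edges [simp]: "finite V \<Longrightarrow> finite (all_edges V)"
  by (simp add: all_edges_def)

text \<open>Translation by \<open>X\<close> carries \<open>{}\<close> to \<open>X\<close>, so
  invariance gives all subsets of \<open>A\<close> the same mass.\<close>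

lemma pmf_of_set_Pow_eqI:
  assumes "finite A" and supp: "set_pmf M \<subseteq> Pow A"
    and inv: "\<And>X. X \<subseteq> A \<Longrightarrow> map_pmf (\<lambda>S. sym_diff S X) M = M"
  shows "M = pmf_of_set (Pow A)"
proof -
  have const: "pmf M X = pmf M {}" if "X \<subseteq> A" for X
  proof -
    have "inj (\<lambda>S. sym_diff S X)"
      by (rule injI) blast
    from pmf_map_inj'[OF this, of M "{}"] show ?thesis
      using inv[OF that] by simp
  qed
  have "(\<Sum>X\<in>Pow A. pmf M X) = 1"
    using assms by (intro sum_pmf_eq_1) auto
  moreover have "(\<Sum>X\<in>Pow A. pmf M X) = (\<Sum>X\<in>Pow A. pmf M {})"
    by (intro sum.cong refl const) auto
  ultimately have "2 ^ card A * pmf M {} = 1"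
    using assms(1) by (simp add: card_Pow)
  then have val: "pmf M {} = 1 / 2 ^ card A"
    by (simp add: field_simps)
  show ?thesis
  proof (rule pmf_eqI)
    fix X
    have U: "pmf (pmf_of_set (Pow A)) X = indicator (Pow A) X / card (Pow A)"
      using assms(1) by (intro pmf_of_set) auto
    show "pmf M X = pmf (pmf_of_set (Pow A)) X"
    proof (cases "X \<subseteq> A")
      case True
      then show ?thesis
        using const[OF True] val U assms(1) by (simp add: card_Pow)
    next
      case False
      then have "pmf M X = 0"
        using supp by (auto simp: pmf_eq_0_set_pmf)
      then show ?thesis
        using False U by simp
    qed
  qed
qed

text \<open>Flipping edges at a single vertex of \<open>C\<close> realises every translation of \<open>Odd(C) - C\<close>; this is why
  \<open>Odd(C) - C\<close> is uniform.\<close>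

lemma odd_nbhd_sym_diff_star:
  assumes "finite V" "C \<subseteq> V" "c \<in> C" "X \<subseteq> V - C"
  shows "odd_nbhd (V, sym_diff F ((\<lambda>v. {c, v}) ` X)) C - C = sym_diff (odd_nbhd (V, F) C - C) X"
proof (rule set_eqI)
  fix v
  let ?F = "sym_diff F ((\<lambda>v. {c, v}) ` X)"
  show "v \<in> odd_nbhd (V, ?F) C - C \<longleftrightarrow> v \<in> sym_diff (odd_nbhd (V, F) C - C) X"
  proof (cases "v \<in> V - C")
    case False
    then show ?thesis
      using assms by (auto simp: odd_nbhd_def)
  next
    case True
    \<comment> \<open>As \<open>v\<close> lies outside \<open>C\<close> and \<open>c\<close> inside,
      the two endpoints cannot be swapped.\<close>
    have mem: "{u, v} \<in> (\<lambda>v. {c, v}) ` X \<longleftrightarrow> u = c \<and> v \<in> X" if "u \<in> C" for u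
      using that True assms(3,4) by (auto simp: doubleton_eq_iff)
    have "finite C"
      using assms finite_subset by blast
    have "C \<inter> {u. {u, v} \<in> ?F} = sym_diff (C \<inter> {u. {u, v} \<in> F}) (if v \<in> X then {c} else {})"
      using mem assms(3) by auto
    then have "odd (card (C \<inter> {u. {u, v} \<in> ?F})) \<longleftrightarrow> odd (card (C \<inter> {u. {u, v} \<in> F})) \<noteq> (v \<in> X)"
      using odd_card_sym_diff[of "C \<inter> {u. {u, v} \<in> F}" "if v \<in> X then {c} else {}"] \<open>finite C\<close>
      by auto
    then show ?thesis
      using True assms(2) by (auto simp: odd_nbhd_def neighbourhood_Int_eq)
  qed
qed

lemma odd_nbhd_uniform:
  assumes "finite V" "C \<subseteq> V" "C \<noteq> {}"
  shows "map_pmf (\<lambda>F. odd_nbhd (V, F) C - C) (pmf_of_set (Pow (all_edges V))) =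
         pmf_of_set (Pow (V - C))"
proof (rule pmf_of_set_Pow_eqI)
  show "set_pmf (map_pmf (\<lambda>F. odd_nbhd (V, F) C - C) (pmf_of_set (Pow (all_edges V)))) \<subseteq> Pow (V - C)"
    by (auto simp: odd_nbhd_def)
next
  fix X assume X: "X \<subseteq> V - C"
  obtain c where c: "c \<in> C"
    using assms by blast
  let ?t = "\<lambda>F. sym_diff F ((\<lambda>v. {c, v}) ` X)"
  let ?U = "pmf_of_set (Pow (all_edges V))"
  have star: "(\<lambda>v. {c, v}) ` X \<subseteq> all_edges V"
    using c X assms(2) by (force simp: all_edges_def card_insert_if)
  \<comment> \<open>Toggling the star of edges from \<open>c\<close> to \<open>X\<close> is an
    involution on edge sets, hence preserves the uniform distribution.\<close>
  have "bij_betw ?t (Pow (all_edges V)) (Pow (all_edges V))"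
    by (rule bij_betwI[of _ _ _ ?t]) (use star in auto)
  then have t: "map_pmf ?t ?U = ?U"
    using assms(1) by (intro map_pmf_of_set_bij_betw) auto
  have "map_pmf (\<lambda>S. sym_diff S X) (map_pmf (\<lambda>F. odd_nbhd (V, F) C - C) ?U) =
        map_pmf (\<lambda>F. odd_nbhd (V, F) C - C) (map_pmf ?t ?U)"
    unfolding map_pmf_comp odd_nbhd_sym_diff_star[OF assms(1,2) c X] ..
  then show "map_pmf (\<lambda>S. sym_diff S X) (map_pmf (\<lambda>F. odd_nbhd (V, F) C - C) ?U) =
             map_pmf (\<lambda>F. odd_nbhd (V, F) C - C) ?U"
    unfolding t .
qed (use assms in auto)

lemma random_graph_half:
  "random_graph n (1 / 2) = map_pmf (Pair {..<n}) (pmf_of_set (Pow (all_edges {..<n})))"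
proof -
  have "random_graph n (1 / 2) = map_pmf (Pair {..<n})
      (map_pmf (\<lambda>f. {e \<in> all_edges {..<n}. f e})
        (Pi_pmf (all_edges {..<n}) False (\<lambda>_. bernoulli_pmf (1 / 2))))"
    by (simp add: random_graph_def map_pmf_comp)
  then show ?thesis
    by (simp add: pmf_of_set_Pow_conv_bernoulli)
qed

lemma random_graph_half_odd_nbhd:
  assumes "C \<subseteq> {..<n}" "C \<noteq> {}"
  shows "map_pmf (\<lambda>G. odd_nbhd G C - C) (random_graph n (1 / 2)) = pmf_of_set (Pow ({..<n} - C))"
  using odd_nbhd_uniform[OF _ assms] by (simp add: random_graph_half map_pmf_comp)

section \<open>Tail bounds\<close>

lemma sum_Pow_power_card:
  fixes x :: "'a :: comm_semiring_1"
  assumes "finite A"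
  shows "(\<Sum>S\<in>Pow A. x ^ card S) = (1 + x) ^ card A"
  using prod_add[OF assms, of "\<lambda>_. x" "\<lambda>_. 1"] by (simp add: add.commute)

lemma sum_Pow_power_card_Diff:
  fixes x :: "'a :: comm_semiring_1"
  assumes "finite A"
  shows "(\<Sum>S\<in>Pow A. x ^ card (A - S)) = (1 + x) ^ card A"
  using prod_add[OF assms, of "\<lambda>_. 1" "\<lambda>_. x"] by simp

text \<open>Markov's inequality for \<open>x ^ card S\<close>, whose mean under the uniform
  distribution is \<open>((1 + x) / 2) ^ card A\<close>.\<close>

lemma prob_uniform_subset_card_ge:
  fixes x r :: real
  assumes "finite A" "1 < x"
  shows "measure_pmf.prob (pmf_of_set (Pow A)) {S. r \<le> card S} \<le> ((1 + x) / 2) ^ card A / x powr r"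
proof -
  let ?T = "{S \<in> Pow A. r \<le> card S}"
  have "card ?T * x powr r = (\<Sum>S\<in>?T. x powr r)"
    by simp
  also have "\<dots> \<le> (\<Sum>S\<in>?T. x ^ card S)"
    using assms(2) by (intro sum_mono) (auto simp flip: powr_realpow)
  also have "\<dots> \<le> (\<Sum>S\<in>Pow A. x ^ card S)"
    using assms by (intro sum_mono2) auto
  also have "\<dots> = (1 + x) ^ card A"
    using assms(1) by (rule sum_Pow_power_card)
  finally have "card ?T \<le> (1 + x) ^ card A / x powr r"
    using assms(2) by (simp add: field_simps)
  then have "card ?T / 2 ^ card A \<le> (1 + x) ^ card A / x powr r / 2 ^ card A"
    by (rule divide_right_mono) simp
  moreover have "Pow A \<inter> {S. r \<le> card S} = ?T"
    by auto
  moreover have "measure_pmf.prob (pmf_of_set (Pow A)) {S. r \<le> card S} =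
      card (Pow A \<inter> {S. r \<le> card S}) / card (Pow A)"
    using assms(1) by (intro measure_pmf_of_set) auto
  ultimately show ?thesis
    using assms(1) by (simp add: card_Pow power_divide mult.commute)
qed

lemma prob_uniform_subset_card_Diff_ge:
  fixes x r :: real
  assumes "finite A" "1 < x"
  shows "measure_pmf.prob (pmf_of_set (Pow A)) {S. r \<le> card (A - S)} \<le>
         ((1 + x) / 2) ^ card A / x powr r"
proof -
  have "bij_betw (\<lambda>S. A - S) (Pow A) (Pow A)"
    by (rule bij_betwI[of _ _ _ "\<lambda>S. A - S"]) auto
  then have "map_pmf (\<lambda>S. A - S) (pmf_of_set (Pow A)) = pmf_of_set (Pow A)"
    using assms(1) by (intro map_pmf_of_set_bij_betw) auto
  then have "measure_pmf.prob (pmf_of_set (Pow A)) {S. r \<le> card S} =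
      measure_pmf.prob (map_pmf (\<lambda>S. A - S) (pmf_of_set (Pow A))) {S. r \<le> card S}"
    by simp
  also have "\<dots> = measure_pmf.prob (pmf_of_set (Pow A)) {S. r \<le> card (A - S)}"
    by (simp add: vimage_def)
  finally show ?thesis
    using prob_uniform_subset_card_ge[OF assms, of r] by simp
qed

lemma prob_kappa_Q_ge:
  fixes x r :: real
  assumes "0 < n" "0 < r" "1 < x"
  shows "measure_pmf.prob (random_graph n (1 / 2)) {G. r \<le> kappa_Q G} \<le>
         2 * ((3 + x) / 2) ^ n / x powr r"
proof -
  let ?M = "random_graph n (1 / 2)"
  let ?V = "{..<n}"
  let ?CC = "Pow ?V - {{}}"
  let ?E1 = "\<lambda>C. {G. r \<le> card (odd_nbhd G C - C)}"
  let ?E2 = "\<lambda>C. {G. r \<le> card (?V - C - (odd_nbhd G C - C))}"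
  let ?p = "\<lambda>C. ((1 + x) / 2) ^ card (?V - C) / x powr r"
  have E: "measure_pmf.prob ?M (?E1 C \<union> ?E2 C) \<le> 2 * ?p C" if "C \<in> ?CC" for C
  proof -
    let ?N = "map_pmf (\<lambda>G. odd_nbhd G C - C) ?M"
    have N: "?N = pmf_of_set (Pow (?V - C))"
      using that by (intro random_graph_half_odd_nbhd) auto
    have "measure_pmf.prob ?M (?E1 C) = measure_pmf.prob ?N {S. r \<le> card S}"
      by (simp add: vimage_def)
    also have "\<dots> \<le> ?p C"
      unfolding N using assms by (intro prob_uniform_subset_card_ge) auto
    finally have 1: "measure_pmf.prob ?M (?E1 C) \<le> ?p C" .
    have "measure_pmf.prob ?M (?E2 C) = measure_pmf.prob ?N {S. r \<le> card (?V - C - S)}"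
      by (simp add: vimage_def)
    also have "\<dots> \<le> ?p C"
      unfolding N using assms by (intro prob_uniform_subset_card_Diff_ge) auto
    finally have 2: "measure_pmf.prob ?M (?E2 C) \<le> ?p C" .
    have "measure_pmf.prob ?M (?E1 C \<union> ?E2 C) \<le>
        measure_pmf.prob ?M (?E1 C) + measure_pmf.prob ?M (?E2 C)"
      by (rule measure_Un_le) auto
    with 1 2 show ?thesis by linarith
  qed
  have "measure_pmf.prob ?M {G. r \<le> kappa_Q G} \<le> measure_pmf.prob ?M (\<Union>C\<in>?CC. ?E1 C \<union> ?E2 C)"
  proof (intro measure_pmf.finite_measure_mono_AE)
    \<comment> \<open>The inclusion is claimed on the support, where the vertex set is known to be
      \<open>{..<n}\<close>.\<close>
    show "AE G in measure_pmf ?M. G \<in> {G. r \<le> kappa_Q G} \<longrightarrow> G \<in> (\<Union>C\<in>?CC. ?E1 C \<union> ?E2 C)"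
    proof (intro AE_pmfI impI)
      fix G assume "G \<in> set_pmf ?M" and r: "G \<in> {G. r \<le> kappa_Q G}"
      then have V: "verts G = ?V"
        using simple_random_graph(1) by blast
      then obtain C where "C \<subseteq> ?V" "C \<noteq> {}"
          "r \<le> card (odd_nbhd G C - C) \<or> r \<le> card (?V - C - (odd_nbhd G C - C))"
        using kappa_Q_ge_witness[of G r] r assms by auto
      then show "G \<in> (\<Union>C\<in>?CC. ?E1 C \<union> ?E2 C)"
        by blast
    qed
  qed auto
  also have "\<dots> \<le> (\<Sum>C\<in>?CC. measure_pmf.prob ?M (?E1 C \<union> ?E2 C))"
    by (rule measure_UNION_le) auto
  also have "\<dots> \<le> (\<Sum>C\<in>?CC. 2 * ?p C)"
    by (intro sum_mono E)
  \<comment> \<open>Restoring \<open>C = {}\<close> adds a nonnegative term and makes the binomial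
    theorem applicable.\<close>
  also have "\<dots> \<le> (\<Sum>C\<in>Pow ?V. 2 * ?p C)"
    using assms by (intro sum_mono2) auto
  also have "\<dots> = 2 * (\<Sum>C\<in>Pow ?V. ((1 + x) / 2) ^ card (?V - C)) / x powr r"
    by (simp add: sum_distrib_left sum_divide_distrib)
  also have "\<dots> = 2 * (1 + (1 + x) / 2) ^ n / x powr r"
    by (subst sum_Pow_power_card_Diff) auto
  also have "1 + (1 + x) / 2 = (3 + x) / 2"
    by (simp add: field_simps)
  finally show ?thesis .
qed

text \<open>\<open>30 / 37\<close> is a fraction with small denominator between \<open>ln 8 / ln 13\<close> and \<open>0.811\<close>.\<close>

lemma eight_less_13_powr: "8 < 13 powr (0.811 :: real)"
proof -
  have "(8 :: real) ^ 37 < 13 ^ 30"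
    by simp
  also have "\<dots> = (13 powr (30 / 37)) ^ 37"
    by (simp add: powr_power)
  finally have "8 < 13 powr (30 / 37 :: real)"
    by (rule power_less_imp_less_base) simp
  also have "\<dots> < 13 powr (0.811 :: real)"
    by (rule powr_less_mono) simp_all
  finally show ?thesis .
qed

theorem theorem9:
  shows "\<exists>n0::nat. \<forall>n>n0.
    measure_pmf.prob (random_graph n (1 / 2)) {G. real (kappa_Q G) < 0.811 * real n}
      \<ge> 1 - 1 / real n"
proof -
  define q :: real where "q = 8 / 13 powr 0.811"
  have "(\<lambda>n. real n * q ^ n) \<longlonglongrightarrow> 0"
    using eight_less_13_powr by (intro powser_times_n_limit_0) (simp add: q_def)
  \<comment> \<open>The bound \<open>1 / 2\<close> absorbs the factor 2 from the two tail events: it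
    yields \<open>2 * q ^ n \<le> 1 / real n\<close>.\<close>
  then have "\<forall>\<^sub>F n in sequentially. real n * q ^ n < 1 / 2"
    by (rule order_tendstoD) simp
  then obtain n0 where n0: "real n * q ^ n < 1 / 2" if "n0 \<le> n" for n
    by (auto simp: eventually_sequentially)
  have "1 - 1 / real n \<le>
      measure_pmf.prob (random_graph n (1 / 2)) {G. real (kappa_Q G) < 0.811 * real n}"
    if "n0 < n" for n
  proof -
    let ?P = "measure_pmf.prob (random_graph n (1 / 2))"
    have "0 < n"
      using that by simp
    have "?P {G. 0.811 * real n \<le> kappa_Q G} \<le> 2 * ((3 + 13) / 2) ^ n / 13 powr (0.811 * real n)"
      using \<open>0 < n\<close> by (intro prob_kappa_Q_ge) auto
    also have "13 powr (0.811 * real n) = (13 powr 0.811) ^ n"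
      by (simp add: powr_power mult.commute)
    also have "2 * ((3 + 13) / 2) ^ n / (13 powr 0.811) ^ n = 2 * q ^ n"
      by (simp add: q_def power_divide)
    also have "\<dots> \<le> 1 / real n"
      using n0[of n] that \<open>0 < n\<close> by (simp add: field_simps)
    finally have "?P {G. 0.811 * real n \<le> kappa_Q G} \<le> 1 / real n" .
    moreover have "?P {G. real (kappa_Q G) < 0.811 * real n} =
        1 - ?P {G. 0.811 * real n \<le> kappa_Q G}"
    proof -
      have "{G. real (kappa_Q G) < 0.811 * real n} = - {G :: nat ugraph. 0.811 * real n \<le> kappa_Q G}"
        by auto
      then show ?thesis
        using measure_pmf.prob_compl[of "{G. 0.811 * real n \<le> kappa_Q G}" "random_graph n (1 / 2)"]
        by (simp add: Compl_eq_Diff_UNIV)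
    qed
    ultimately show ?thesis
      by simp
  qed
  then show ?thesis
    by blast
qed

end
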